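(* Let $R, r, L > 0$, let $\mathbb{B}_2^n$ be the closed Euclidean unit ball of $\mathbb{R}^n$, and let $K \subset \mathbb{R}^n$ be a convex body satisfying $z + r\mathbb{B}_2^n \subset K \subset R\,\mathbb{B}_2^n$ for some $z \in \mathbb{R}^n$, given by a separation oracle $\mathcal{A}$. Let $f\colon \mathbb{R}^n \to \mathbb{R}$ be a convex function that is $L$-Lipschitz, i.e. $|f(x)-f(y)| \le L\|x-y\|_2$ for all $x,y\in\mathbb{R}^n$, given by a subgradient oracle. Apply the Algorithm (described in the context) to the function $g := \frac{1}{RL} f$, using the norm $\|(x,y)\| := \sqrt{2}\,\|(x/R,y)\|_2$ on $\mathbb{R}^{n}\times\mathbb{R}$ and the potential $\Phi(a,b) := \frac14 \|(Ra,b)\|_2^2$. Let $\mathrm{UB}$ denote $RL$ times the upper-bound value maintained by the Algorithm for $g$, i.e. $\mathrm{UB}$ is the minimum of $f(x_t)$ over all query points $x_t \in K$ produced so far ($+\infty$ if there are none). Then, for every $\varepsilon > 0$, after $$T = O\left(\frac{R^2}{r^2}\cdot\frac{R^2L^2}{\varepsilon^2}\right)$$ iterations we have $\mathrm{UB} \ge \min_{x\in K} f(x) \ge \mathrm{UB} - \varepsilon$. (The constant hidden in $O(\cdot)$ is absolute.)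
   Context: A convex body is a compact convex set with nonempty interior. For $v\in\mathbb{R}^{n+1}$, $v[1{:}n]$ denotes its first $n$ coordinates and $v[n+1]$ its last coordinate; $\langle\cdot,\cdot\rangle$ is the standard inner product. $\|\cdot\|_*$ denotes the dual norm of $\|\cdot\|$: $\|q\|_* = \max\{\langle q,v\rangle : \|v\|\le 1\}$. Separation oracle: $\mathcal{A}\subseteq\mathbb{R}^{n+1}$ is a set of points $(a,b)$ ($a \in \mathbb{R}^n$, $b \in \mathbb{R}$) such that $\langle a,y\rangle\le b$ for all $y\in K$. Given $x\in\mathbb{R}^n$, the oracle either asserts that $x\in K$ or (if $x\notin K$) returns some $(a,b)\in\mathcal{A}$ with $\langle a,x\rangle>b$. Subgradient oracle: for a convex function $g$, $\nabla g(x)$ denotes an arbitrary subgradient of $g$ at $x$, returned by the oracle together with $g(x)$. Algorithm (for a convex objective $g\colon\mathbb{R}^n\to\mathbb{R}$, a convex body $K$ with separation oracle $\mathcal{A}$, a norm $\|\cdot\|$ on $\mathbb{R}^{n+1}$, and a strictly convex differentiable $\Phi\colon\mathbb{R}^{n+1}\to\mathbb{R}_+$ with $\min\Phi=\Phi(\mathbf{0})=0$). Initialize the upper-bound value $\leftarrow\infty$, $A_1\leftarrow\{(\mathbf{0},1)/\|(\mathbf{0},1)\|_*\}$, $G_1\leftarrow\emptyset$. For iterations $t=1,2,\dots,T$: 1. $p_t\leftarrow\arg\min\{\Phi(p): p\in\operatorname{conv}(A_t\cup G_t)\}$. 2. If $p_t=\mathbf{0}$, stop and return the current upper-bound value. 3.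 $x_t\leftarrow -\nabla\Phi(p_t)[1{:}n]/\nabla\Phi(p_t)[n+1]$. 4. If $x_t\in K$: replace the upper-bound value by its minimum with $g(x_t)$, set $A_{t+1}\leftarrow A_t$ and $G_{t+1}\leftarrow G_t\cup\{(\nabla g(x_t),\langle\nabla g(x_t),x_t\rangle)\}$. 5. If $x_t\notin K$: get $(a,b)\in\mathcal{A}$ from the oracle with $\langle a,x_t\rangle>b$, normalized so that $\|(a,b)\|_*=1$; set $A_{t+1}\leftarrow A_t\cup\{(a,b)\}$ and $G_{t+1}\leftarrow G_t$. After iteration $T$, return the current upper-bound value. The number $T$ need not be fixed in advance; the Algorithm may be stopped at any time. If it stops early in step 2, the value returned there counts as its value after any later number of iterations.
   Formalization: The iteration bound is proved as 1000·(R²/r²)·max(1, R²L²/ε²), so for ε > RL it reads O(R²/r²); the bound as stated fails for very large ε, since no point of K need have been queried yet. *)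

theory Defs
  imports "HOL-Analysis.Analysis"
begin

(* The space R^(n+1) is rendered as 'a \<times> real with 'a = R^n, so v[1:n] is fst v and v[n+1] is snd v.
   The product norm and inner product of HOL-Analysis are the Euclidean ones. *)

definition convex_body :: "'a::euclidean_space set \<Rightarrow> bool" where
  "convex_body K \<longleftrightarrow> compact K \<and> convex K \<and> interior K \<noteq> {}"

(* The supremum is a maximum whenever N is a norm on a finite-dimensional space. *)
definition dual_norm :: "('b::real_inner \<Rightarrow> real) \<Rightarrow> 'b \<Rightarrow> real" where
  "dual_norm N q = (SUP v\<in>{v. N v \<le> 1}. inner q v)"

definition separation_oracle :: "'a::euclidean_space set \<Rightarrow> ('a \<times> real) set \<Rightarrow> bool" where
  "separation_oracle K \<A> \<longleftrightarrow>
     (\<forall>(a, b)\<in>\<A>. \<forall>y\<in>K. inner a y \<le> b) \<and>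
     (\<forall>x. x \<notin> K \<longrightarrow> (\<exists>(a, b)\<in>\<A>. inner a x > b))"

definition subgradient :: "('a::real_inner \<Rightarrow> real) \<Rightarrow> 'a \<Rightarrow> 'a \<Rightarrow> bool" where
  "subgradient g x h \<longleftrightarrow> (\<forall>y. g y \<ge> g x + inner h (y - x))"

definition gradient :: "('b::real_inner \<Rightarrow> real) \<Rightarrow> 'b \<Rightarrow> 'b" where
  "gradient \<Phi> p = (THE d. GDERIV \<Phi> p :> d)"

record 'a alg_state =
  ub :: ereal
  cuts :: "('a \<times> real) set"
  subs :: "('a \<times> real) set"
  stopped :: bool

definition init_state :: "('a::euclidean_space \<times> real \<Rightarrow> real) \<Rightarrow> 'a alg_state" where
  "init_state N =
     \<lparr>ub = \<infinity>, cuts = {(1 / dual_norm N (0, 1)) *\<^sub>R (0, 1)}, subs = {}, stopped = False\<rparr>"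

definition query_point :: "('a::euclidean_space \<times> real \<Rightarrow> real) \<Rightarrow> 'a \<times> real \<Rightarrow> 'a" where
  "query_point \<Phi> p = - ((1 / snd (gradient \<Phi> p)) *\<^sub>R fst (gradient \<Phi> p))"

definition min_point ::
  "('a::euclidean_space \<times> real \<Rightarrow> real) \<Rightarrow> 'a alg_state \<Rightarrow> 'a \<times> real \<Rightarrow> bool" where
  "min_point \<Phi> s p \<longleftrightarrow> is_arg_min \<Phi> (\<lambda>p. p \<in> convex hull (cuts s \<union> subs s)) p"

(* One iteration. It is a relation because the answers of both oracles are arbitrary (and may depend
   on the history); a statement about all runs therefore covers every behaviour of the oracles.
   A run that has stopped keeps its state, so its upper bound persists. *)
inductive iteration ::
  "('a::euclidean_space \<Rightarrow> real) \<Rightarrow> 'a set \<Rightarrow> ('a \<times> real) set \<Rightarrow> ('a \<times> real \<Rightarrow> real) \<Rightarrow>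
   ('a \<times> real \<Rightarrow> real) \<Rightarrow> 'a alg_state \<Rightarrow> 'a alg_state \<Rightarrow> bool"
  for g K \<A> N \<Phi> where
  already_stopped:
    "stopped s \<Longrightarrow> iteration g K \<A> N \<Phi> s s"
| stop:
    "\<lbrakk>\<not> stopped s; min_point \<Phi> s 0\<rbrakk> \<Longrightarrow> iteration g K \<A> N \<Phi> s (s\<lparr>stopped := True\<rparr>)"
| feasible:
    "\<lbrakk>\<not> stopped s; min_point \<Phi> s p; p \<noteq> 0; x = query_point \<Phi> p; x \<in> K; subgradient g x h\<rbrakk> \<Longrightarrow>
     iteration g K \<A> N \<Phi> s
       (s\<lparr>ub := min (ub s) (ereal (g x)), subs := subs s \<union> {(h, inner h x)}\<rparr>)"
| infeasible:
    "\<lbrakk>\<not> stopped s; min_point \<Phi> s p; p \<noteq> 0; x = query_point \<Phi> p; x \<notin> K;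
      (a, b) \<in> \<A>; inner a x > b\<rbrakk> \<Longrightarrow>
     iteration g K \<A> N \<Phi> s
       (s\<lparr>cuts := cuts s \<union> {(1 / dual_norm N (a, b)) *\<^sub>R (a, b)}\<rparr>)"

definition state_after ::
  "('a::euclidean_space \<Rightarrow> real) \<Rightarrow> 'a set \<Rightarrow> ('a \<times> real) set \<Rightarrow> ('a \<times> real \<Rightarrow> real) \<Rightarrow>
   ('a \<times> real \<Rightarrow> real) \<Rightarrow> nat \<Rightarrow> 'a alg_state \<Rightarrow> bool" where
  "state_after g K \<A> N \<Phi> T s \<longleftrightarrow> (iteration g K \<A> N \<Phi> ^^ T) (init_state N) s"

end

theory Submission
  imports Defs
begin

text \<open>
  After the rescaling (a, b) \<mapsto> (R a, b) the potential is a quarter of the squared Euclidean norm and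
  every point added to the hull has norm at most sqrt 2 and is in the closed half-space opposite to
  the current minimizer, since x is the query point of that minimizer. Hence one step
  of Frank--Wolfe type decreases the squared distance d of the hull to the origin to
  at most 2 d / (d + 2), so it is at most 2 / (t + 1) after t iterations.
  Conversely, suppose that the upper bound is off by more than \<epsilon>. Pull the minimizer of f slightly
  towards the centre z: at the resulting point y all cuts (a, b) have slack b - \<langle>a, y\<rangle> of order
  \<epsilon> r / R, and so have the points that come from subgradients. This linear
  functional of (a, b) has norm at most sqrt 2 after rescaling, so the hull stays at distance of order
  \<epsilon> r / R from the origin.
\<close>

section \<open>Rescaled coordinates, the dual norm and the query point\<close>

definition rescale :: "real \<Rightarrow> 'a::euclidean_space \<times> real \<Rightarrow> 'a \<times> real" where
  "rescale R p = (R *\<^sub>R fst p, snd p)"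

text \<open>Abbreviations, so that the lemmas speak of the very terms in the theorem and its
  assumptions apply without unfolding.\<close>

abbreviation primal_norm :: "real \<Rightarrow> 'a::euclidean_space \<times> real \<Rightarrow> real" where
  "primal_norm R \<equiv> \<lambda>(x, y). sqrt 2 * norm ((1 / R) *\<^sub>R x, y)"

abbreviation potential :: "real \<Rightarrow> 'a::euclidean_space \<times> real \<Rightarrow> real" where
  "potential R \<equiv> \<lambda>(a, b). 1 / 4 * (norm (R *\<^sub>R a, b))\<^sup>2"

abbreviation hull_of :: "('a::euclidean_space) alg_state \<Rightarrow> ('a \<times> real) set" where
  "hull_of s \<equiv> convex hull (cuts s \<union> subs s)"

lemma linear_rescale: "linear (rescale R)"
  by (auto simp: rescale_def linear_iff scaleR_add_right)

lemma rescale_simps [simp]: "rescale R (a, b) = (R *\<^sub>R a, b)" "rescale R 0 = 0"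
  by (auto simp: rescale_def zero_prod_def)

lemma rescale_eq_0_iff: "R > 0 \<Longrightarrow> rescale R p = 0 \<longleftrightarrow> p = 0"
  by (cases p) (auto simp: zero_prod_def)

lemma norm_rescale_sq: "(norm (rescale R (a, b)))\<^sup>2 = R\<^sup>2 * (norm a)\<^sup>2 + b\<^sup>2"
  by (simp add: norm_Pair power_mult_distrib)

lemma potential_eq: "potential R p = (norm (rescale R p))\<^sup>2 / 4"
  by (cases p) simp

text \<open>The primal norm is sqrt 2 times the Euclidean norm after x is divided by R, so duality
  inverts both factors. Cauchy-Schwarz gives the upper bound, and the supremum is attained.\<close>

lemma dual_norm_primal_norm:
  fixes q :: "'a::euclidean_space \<times> real"
  assumes "R > 0"
  shows "dual_norm (primal_norm R) q = norm (rescale R q) / sqrt 2"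
  unfolding dual_norm_def
proof (rule cSup_eq_maximum)
  obtain a b where q: "q = (a, b)" by (cases q)
  define m where "m = norm (rescale R q)"
  \<comment> \<open>The equality case of Cauchy-Schwarz, scaled to norm 1. For \<open>m = 0\<close>
    division by zero makes \<open>v\<close> the zero vector, which still attains the value
    0.\<close>
  define v where "v = (1 / (sqrt 2 * m)) *\<^sub>R (R\<^sup>2 *\<^sub>R a, b)"
  have "((1 / R) *\<^sub>R fst v, snd v) = (1 / (sqrt 2 * m)) *\<^sub>R rescale R q"
    using assms by (simp add: v_def q power2_eq_square)
  then have "primal_norm R v = sqrt 2 * norm ((1 / (sqrt 2 * m)) *\<^sub>R rescale R q)"
    by (simp add: case_prod_beta)
  also have "\<dots> \<le> 1"
    by (cases "m = 0") (auto simp: m_def)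
  finally have 1: "primal_norm R v \<le> 1" .
  have "inner q v = m\<^sup>2 / (sqrt 2 * m)"
    using norm_rescale_sq[of R a b]
    by (simp add: q v_def m_def inner_Pair dot_square_norm power2_eq_square add_divide_distrib)
  also have "\<dots> = m / sqrt 2"
    by (simp add: power2_eq_square)
  finally show "norm (rescale R q) / sqrt 2 \<in> inner q ` {v. primal_norm R v \<le> 1}"
    using 1 unfolding m_def by (intro image_eqI[of _ _ v]) auto
next
  fix c assume "c \<in> inner q ` {v. primal_norm R v \<le> 1}"
  then obtain x y where c: "c = inner q (x, y)" and v: "sqrt 2 * norm ((1 / R) *\<^sub>R x, y) \<le> 1"
    by auto
  have "c = inner (rescale R q) ((1 / R) *\<^sub>R x, y)"
    using assms by (cases q) (simp add: c inner_Pair)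
  also have "\<dots> \<le> norm (rescale R q) * norm ((1 / R) *\<^sub>R x, y)"
    by (rule norm_cauchy_schwarz)
  also have "\<dots> \<le> norm (rescale R q) * (1 / sqrt 2)"
    using v by (intro mult_left_mono) (auto simp: field_simps)
  finally show "c \<le> norm (rescale R q) / sqrt 2" by simp
qed

lemma norm_rescale_normalized:
  fixes q :: "'a::euclidean_space \<times> real"
  assumes "R > 0" "q \<noteq> 0"
  shows "(norm (rescale R ((1 / dual_norm (primal_norm R) q) *\<^sub>R q)))\<^sup>2 = 2"
  using assms rescale_eq_0_iff[of R q]
  by (simp add: dual_norm_primal_norm linear_scale[OF linear_rescale] power_divide
      power_mult_distrib)

lemma dual_norm_pos:
  fixes q :: "'a::euclidean_space \<times> real"
  assumes "R > 0" "q \<noteq> 0"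
  shows "dual_norm (primal_norm R) q > 0"
  using assms rescale_eq_0_iff[of R q] by (simp add: dual_norm_primal_norm)

lemma gradient_eqI:
  assumes "GDERIV \<Phi> p :> d"
  shows "gradient \<Phi> p = d"
  unfolding gradient_def
proof (rule the_equality[of "\<lambda>d. GDERIV \<Phi> p :> d", OF assms])
  fix d' assume "GDERIV \<Phi> p :> d'"
  then have "(\<lambda>h. inner h d') = (\<lambda>h. inner h d)"
    using assms unfolding gderiv_def by (rule has_derivative_unique)
  then have "inner (d' - d) d' = inner (d' - d) d" by metis
  then have "inner (d' - d) (d' - d) = 0" by (simp only: inner_diff_right[of "d' - d"])
  then show "d' = d" by simp
qed

text \<open>The gradient is half of (R^2 a, b), and the factor 1/2 cancels in the quotient. For
  \<open>b = 0\<close> both sides are 0, since division by zero gives 0.\<close>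

lemma query_point_potential:
  fixes a :: "'a::euclidean_space"
  shows "query_point (potential R) (a, b) = - ((R\<^sup>2 / b) *\<^sub>R a)"
proof -
  have eq: "potential R = (\<lambda>p. (R\<^sup>2 * inner (fst p) (fst p) + (snd p)\<^sup>2) / 4)"
    by (auto simp: fun_eq_iff norm_Pair power_mult_distrib power2_norm_eq_inner)
  have "GDERIV (potential R) (a, b) :> ((R\<^sup>2 / 2) *\<^sub>R a, b / 2)"
    unfolding gderiv_def eq
    by (auto intro!: derivative_eq_intros
        simp: inner_Pair fun_eq_iff power2_eq_square inner_commute field_simps)
  then show ?thesis
    by (simp add: query_point_def gradient_eqI)
qed

section \<open>One Frank-Wolfe step towards the origin\<close>

lemma shrink_step:
  fixes u q :: "'a::real_inner"
  assumes "(norm q)\<^sup>2 \<le> 2" "inner u q \<le> 0"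
  obtains l where "0 \<le> l" "l \<le> 1"
    "(norm ((1 - l) *\<^sub>R u + l *\<^sub>R q))\<^sup>2 \<le> 2 * (norm u)\<^sup>2 / ((norm u)\<^sup>2 + 2)"
proof
  define d where "d = (norm u)\<^sup>2"
  \<comment> \<open>The minimizer of (1 - l)^2 d + 2 l^2, which bounds the squared norm once the
    mixed term is dropped as nonpositive and the squared norm of \<open>q\<close> is replaced by
    2.\<close>
  define l where "l = d / (d + 2)"
  have d: "d \<ge> 0" by (simp add: d_def)
  then show l: "0 \<le> l" "l \<le> 1" by (auto simp: l_def)
  have "(norm ((1 - l) *\<^sub>R u + l *\<^sub>R q))\<^sup>2
      = (1 - l)\<^sup>2 * d + 2 * (l * (1 - l)) * inner u q + l\<^sup>2 * (norm q)\<^sup>2"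
    unfolding d_def power2_norm_eq_inner
    by (simp add: inner_commute power2_eq_square algebra_simps)
  also have "\<dots> \<le> (1 - l)\<^sup>2 * d + 0 + l\<^sup>2 * 2"
    using assms l by (intro add_mono mult_left_mono mult_nonneg_nonpos) auto
  also have "\<dots> = 2 * d / (d + 2)"
  proof -
    have "1 - l = 2 / (d + 2)" using d by (simp add: l_def field_simps)
    then have "(1 - l)\<^sup>2 * d + 0 + l\<^sup>2 * 2 = (4 * d + 2 * d\<^sup>2) / (d + 2)\<^sup>2"
      by (simp only: power_divide) (simp add: l_def power_divide add_divide_distrib)
    also have "4 * d + 2 * d\<^sup>2 = (2 * d) * (d + 2)"
      by (simp add: algebra_simps power2_eq_square)
    finally have "(1 - l)\<^sup>2 * d + 0 + l\<^sup>2 * 2 = (2 * d) * (d + 2) / (d + 2)\<^sup>2" .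
    then show ?thesis by (simp add: power2_eq_square)
  qed
  finally show "(norm ((1 - l) *\<^sub>R u + l *\<^sub>R q))\<^sup>2 \<le> 2 * (norm u)\<^sup>2 / ((norm u)\<^sup>2 + 2)"
    by (simp add: d_def)
qed

lemma hull_shrink_step:
  fixes p q :: "'a::euclidean_space \<times> real"
  assumes "p \<in> convex hull S" "(norm (rescale R q))\<^sup>2 \<le> 2" "inner (rescale R p) (rescale R q) \<le> 0"
  obtains p' where "p' \<in> convex hull (insert q S)"
    "(norm (rescale R p'))\<^sup>2 \<le> 2 * (norm (rescale R p))\<^sup>2 / ((norm (rescale R p))\<^sup>2 + 2)"
proof -
  obtain l where l: "0 \<le> l" "l \<le> 1"
    "(norm ((1 - l) *\<^sub>R rescale R p + l *\<^sub>R rescale R q))\<^sup>2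
       \<le> 2 * (norm (rescale R p))\<^sup>2 / ((norm (rescale R p))\<^sup>2 + 2)"
    using shrink_step[OF assms(2,3)] .
  have "p \<in> convex hull (insert q S)"
    using assms(1) hull_mono[of S "insert q S"] by blast
  then have "(1 - l) *\<^sub>R p + l *\<^sub>R q \<in> convex hull (insert q S)"
    using l by (intro convexD[OF convex_convex_hull]) (auto intro: hull_inc)
  moreover have "rescale R ((1 - l) *\<^sub>R p + l *\<^sub>R q) = (1 - l) *\<^sub>R rescale R p + l *\<^sub>R rescale R q"
    by (simp add: linear_add[OF linear_rescale] linear_scale[OF linear_rescale])
  ultimately show ?thesis using l that by metis
qed

text \<open>Otherwise the initial cut makes a non-acute angle with \<open>p\<close>, and a step
  towards it would bring the hull strictly closer to the origin than its minimizer. Positivity makes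
  the division in the query point meaningful and fixes the sign of the angle with a new cut.\<close>

lemma min_point_snd_pos:
  fixes s :: "'a::euclidean_space alg_state"
  assumes "R > 0" "min_point (potential R) s p" "p \<noteq> 0" "(0, sqrt 2) \<in> cuts s"
  shows "snd p > 0"
proof (rule ccontr)
  assume "\<not> snd p > 0"
  then have "inner (rescale R p) (rescale R (0, sqrt 2)) \<le> 0"
    by (cases p) (simp add: inner_Pair mult_nonpos_nonneg)
  moreover have q: "(norm (rescale R (0 :: 'a, sqrt 2)))\<^sup>2 \<le> 2"
    by (simp add: norm_Pair)
  moreover have p: "p \<in> hull_of s"
    and min: "\<And>q. q \<in> hull_of s \<Longrightarrow> (norm (rescale R p))\<^sup>2 \<le> (norm (rescale R q))\<^sup>2"
    using assms(2) unfolding min_point_def is_arg_min_def potential_eq by (auto simp: not_less)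
  \<comment> \<open>The initial cut is already present, so the step stays in the same hull.\<close>
  moreover have "insert (0, sqrt 2) (cuts s \<union> subs s) = cuts s \<union> subs s"
    using assms(4) by auto
  ultimately obtain p' where "p' \<in> hull_of s" and
    "(norm (rescale R p'))\<^sup>2 \<le> 2 * (norm (rescale R p))\<^sup>2 / ((norm (rescale R p))\<^sup>2 + 2)"
    using hull_shrink_step[of p "cuts s \<union> subs s" R "(0, sqrt 2)"] q by metis
  moreover have "(norm (rescale R p))\<^sup>2 > 0"
    using assms(1,3) by (simp add: rescale_eq_0_iff)
  then have "2 * (norm (rescale R p))\<^sup>2 / ((norm (rescale R p))\<^sup>2 + 2) < (norm (rescale R p))\<^sup>2"
    by (simp add: field_simps add_pos_pos)
  ultimately show False using min[of p'] by linarith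
qed

text \<open>Test the subgradient inequality at x + h: the increase of g is at least |h|^2 and at
  most M |h|.\<close>

lemma subgradient_norm_le:
  assumes "subgradient g x h" and "\<And>x y. \<bar>g x - g y\<bar> \<le> M * norm (x - y)" and "M \<ge> 0"
  shows "norm h \<le> M"
proof (cases "h = 0")
  case True
  then show ?thesis using assms(3) by simp
next
  case False
  have "norm h * norm h = inner h (x + h - x)"
    by (simp add: power2_norm_eq_inner flip: power2_eq_square)
  also have "\<dots> \<le> g (x + h) - g x"
    using assms(1) unfolding subgradient_def by (metis add.commute le_diff_eq)
  also have "\<dots> \<le> M * norm h"
    using assms(2)[of "x + h" x] by simp
  finally show ?thesis using False by simp
qed

section \<open>The invariant of a run\<close>

text \<open>The distance bound is kept through a witness instead of the minimizer, so that 0 can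
  serve after a stop. Each subgradient keeps its base point, where g is at least the current bound;
  the last clause makes a finite bound a value of g on K.\<close>

definition run_invariant ::
  "('a::euclidean_space \<Rightarrow> real) \<Rightarrow> 'a set \<Rightarrow> real \<Rightarrow> nat \<Rightarrow> 'a alg_state \<Rightarrow> bool" where
  "run_invariant g K R t s \<longleftrightarrow>
     (stopped s \<longrightarrow> 0 \<in> hull_of s) \<and>
     (\<exists>p\<in>hull_of s. (real t + 1) * (norm (rescale R p))\<^sup>2 \<le> 2) \<and>
     (0, sqrt 2) \<in> cuts s \<and>
     (\<forall>(a, b)\<in>cuts s. (norm (rescale R (a, b)))\<^sup>2 = 2 \<and> (\<forall>y\<in>K. inner a y \<le> b)) \<and>
     (\<forall>(h, c)\<in>subs s. \<exists>x. subgradient g x h \<and> c = inner h x \<and> ub s \<le> ereal (g x)) \<and>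
     (ub s = \<infinity> \<or> (\<exists>x\<in>K. ub s = ereal (g x)))"

text \<open>The initial hull is the single point (0, sqrt 2), for which the distance bound holds
  with equality.\<close>

lemma run_invariant_init:
  fixes K :: "'a::euclidean_space set"
  assumes "R > 0"
  shows "run_invariant g K R 0 (init_state (primal_norm R))"
proof -
  have "1 / dual_norm (primal_norm R) (0 :: 'a, 1) = sqrt 2"
    unfolding dual_norm_primal_norm[OF assms] by (simp add: norm_Pair)
  then have "init_state (primal_norm R) =
      \<lparr>ub = \<infinity>, cuts = {(0 :: 'a, sqrt 2)}, subs = {}, stopped = False\<rparr>"
    by (simp add: init_state_def)
  then show ?thesis
    by (simp add: run_invariant_def norm_Pair)
qed

text \<open>The map d to 2 d / (d + 2) is increasing and adds 1/2 to the reciprocal 1 / d, so the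
  bound 2 / (t + 1) becomes 2 / (t + 2).\<close>

lemma hull_bound_step:
  fixes s :: "'a::euclidean_space alg_state"
  assumes "run_invariant g K R t s" "min_point (potential R) s p"
    and "(norm (rescale R q))\<^sup>2 \<le> 2" "inner (rescale R p) (rescale R q) \<le> 0"
  shows "\<exists>p\<in>convex hull (insert q (cuts s \<union> subs s)). (real (Suc t) + 1) * (norm (rescale R p))\<^sup>2 \<le> 2"
proof -
  define d where "d = (norm (rescale R p))\<^sup>2"
  have p: "p \<in> hull_of s" and min: "\<And>q. q \<in> hull_of s \<Longrightarrow> d \<le> (norm (rescale R q))\<^sup>2"
    using assms(2) unfolding min_point_def is_arg_min_def potential_eq d_def by (auto simp: not_less)
  obtain p0 where "p0 \<in> hull_of s" and p0: "(real t + 1) * (norm (rescale R p0))\<^sup>2 \<le> 2"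
    using assms(1) unfolding run_invariant_def by blast
  have "(real t + 1) * d \<le> (real t + 1) * (norm (rescale R p0))\<^sup>2"
    using min[OF \<open>p0 \<in> hull_of s\<close>] by (intro mult_left_mono) auto
  then have d: "(real t + 1) * d \<le> 2" using p0 by linarith
  have "d \<ge> 0" by (simp add: d_def)
  obtain p' where p': "p' \<in> convex hull (insert q (cuts s \<union> subs s))"
    "(norm (rescale R p'))\<^sup>2 \<le> 2 * d / (d + 2)"
    using hull_shrink_step[OF p assms(3,4)] unfolding d_def .
  have "(real (Suc t) + 1) * (norm (rescale R p'))\<^sup>2 \<le> (real (Suc t) + 1) * (2 * d / (d + 2))"
    using p'(2) by (intro mult_left_mono) auto
  also have "\<dots> \<le> 2"
    using d \<open>d \<ge> 0\<close> by (simp add: field_simps)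
  finally show ?thesis using p'(1) by blast
qed

text \<open>With p = (a, b) the query point satisfies R^2 a = - b x. Hence the rescaled inner
  product of p with a new point (a', b') is b (b' - <a', x>): zero for a subgradient, negative for a
  violated cut.\<close>

lemma run_invariant_step:
  fixes K :: "'a::euclidean_space set"
  assumes "R > 0" "K \<noteq> {}" "K \<subseteq> cball 0 R" "separation_oracle K \<A>"
    and lip: "\<And>x y. \<bar>g x - g y\<bar> \<le> 1 / R * norm (x - y)"
    and inv: "run_invariant g K R t s"
    and "iteration g K \<A> (primal_norm R) (potential R) s s'"
  shows "run_invariant g K R (Suc t) s'"
  using assms(7)
proof cases
  case already_stopped
  then have "\<exists>p\<in>hull_of s. (real (Suc t) + 1) * (norm (rescale R p))\<^sup>2 \<le> 2"
    using inv unfolding run_invariant_def by (intro bexI[of _ 0]) auto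
  then show ?thesis
    using already_stopped inv unfolding run_invariant_def by simp
next
  case stop
  then have "0 \<in> hull_of s" by (simp add: min_point_def is_arg_min_def)
  moreover from this have "\<exists>p\<in>hull_of s. (real (Suc t) + 1) * (norm (rescale R p))\<^sup>2 \<le> 2"
    by (intro bexI[of _ 0]) auto
  ultimately show ?thesis
    using stop inv unfolding run_invariant_def by simp
next
  case (feasible p x h)
  obtain a b where p: "p = (a, b)" by (cases p)
  have b: "b > 0"
    using min_point_snd_pos[of R s p] feasible inv assms(1) by (auto simp: run_invariant_def p)
  have x: "x = - ((R\<^sup>2 / b) *\<^sub>R a)"
    using feasible(5) unfolding p query_point_potential .
  \<comment> \<open>The Lipschitz constant 1 / R gives R |h| \<le> 1, and x in K gives |<h, x>|
    \<le> R |h|. Both rescaled components are thus at most 1 in size, which yields squared norm at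
    most 2.\<close>
  have "norm h \<le> 1 / R"
    using subgradient_norm_le[OF feasible(7) lip] assms(1) by simp
  then have h: "R * norm h \<le> 1" using assms(1) by (simp add: field_simps)
  have "norm x \<le> R" using feasible assms(3) by auto
  then have "\<bar>inner h x\<bar> \<le> norm h * R"
    by (meson Cauchy_Schwarz_ineq2 mult_left_mono norm_ge_zero order_trans)
  then have "\<bar>inner h x\<bar> \<le> 1" using h by (simp add: mult.commute)
  then have "(inner h x)\<^sup>2 \<le> 1" by (simp add: abs_square_le_1)
  moreover have "R\<^sup>2 * (norm h)\<^sup>2 \<le> 1"
    using h assms(1) by (simp add: abs_square_le_1 flip: power_mult_distrib)
  ultimately have q: "(norm (rescale R (h, inner h x)))\<^sup>2 \<le> 2"
    by (subst norm_rescale_sq) simp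
  have "inner (rescale R p) (rescale R (h, inner h x)) \<le> 0"
    using b by (simp add: p x inner_Pair inner_commute power2_eq_square)
  from hull_bound_step[OF inv feasible(3) q this]
  have "\<exists>p\<in>hull_of s'. (real (Suc t) + 1) * (norm (rescale R p))\<^sup>2 \<le> 2"
    by (simp add: feasible(1))
  moreover have "min (ub s) (ereal (g x)) = \<infinity> \<or> (\<exists>y\<in>K. min (ub s) (ereal (g x)) = ereal (g y))"
    using inv feasible(6) unfolding run_invariant_def min_def by auto
  moreover have "\<forall>(h', c)\<in>insert (h, inner h x) (subs s).
      \<exists>y. subgradient g y h' \<and> c = inner h' y \<and> min (ub s) (ereal (g x)) \<le> ereal (g y)"
  \<comment> \<open>Older subgradients keep their base points because the upper bound can only
    decrease; the new one takes \<open>x\<close>.\<close>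
  proof -
    have "\<forall>(h', c)\<in>subs s. \<exists>y. subgradient g y h' \<and> c = inner h' y \<and> ub s \<le> ereal (g y)"
      using inv unfolding run_invariant_def by blast
    then show ?thesis
      using feasible(7) by (fastforce intro: min.coboundedI1)
  qed
  ultimately show ?thesis
    using inv feasible(1,2) unfolding run_invariant_def by simp
next
  case (infeasible p x a' b')
  obtain a b where p: "p = (a, b)" by (cases p)
  have b: "b > 0"
    using min_point_snd_pos[of R s p] infeasible inv assms(1) by (auto simp: run_invariant_def p)
  have x: "x = - ((R\<^sup>2 / b) *\<^sub>R a)"
    using infeasible(5) unfolding p query_point_potential .
  have cut: "\<forall>y\<in>K. inner a' y \<le> b'"
    using assms(4) infeasible(7) unfolding separation_oracle_def by auto
  \<comment> \<open>A zero pair cannot violate the cut inequality strictly, so the normalization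
    divides by a positive number.\<close>
  have "(a', b') \<noteq> 0"
    using infeasible(8) by (auto simp: zero_prod_def)
  define l where "l = 1 / dual_norm (primal_norm R) (a', b')"
  have l: "l > 0"
    using dual_norm_pos[OF assms(1) \<open>(a', b') \<noteq> 0\<close>] by (simp add: l_def)
  have q: "(norm (rescale R (l *\<^sub>R (a', b'))))\<^sup>2 = 2"
    unfolding l_def by (rule norm_rescale_normalized[OF assms(1) \<open>(a', b') \<noteq> 0\<close>])
  have "inner (rescale R p) (rescale R (l *\<^sub>R (a', b'))) = l * b * (b' - inner a' x)"
    using b by (simp add: p x inner_Pair inner_commute power2_eq_square algebra_simps)
  also have "\<dots> \<le> 0"
    using l b infeasible(8) by (intro mult_nonneg_nonpos) auto
  finally have "inner (rescale R p) (rescale R (l *\<^sub>R (a', b'))) \<le> 0" .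
  from hull_bound_step[OF inv infeasible(3) eq_refl[OF q] this]
  have "\<exists>p\<in>hull_of s'. (real (Suc t) + 1) * (norm (rescale R p))\<^sup>2 \<le> 2"
    by (simp add: infeasible(1) l_def)
  moreover have "\<forall>(a, b)\<in>insert (l *\<^sub>R (a', b')) (cuts s).
      (norm (rescale R (a, b)))\<^sup>2 = 2 \<and> (\<forall>y\<in>K. inner a y \<le> b)"
    using inv q cut l unfolding run_invariant_def by simp
  moreover have "s' = s\<lparr>cuts := insert (l *\<^sub>R (a', b')) (cuts s)\<rparr>"
    by (simp add: infeasible(1) l_def)
  ultimately show ?thesis
    using inv infeasible(2) unfolding run_invariant_def by simp
qed

lemma run_invariant_state_after:
  fixes K :: "'a::euclidean_space set"
  assumes "R > 0" "K \<noteq> {}" "K \<subseteq> cball 0 R" "separation_oracle K \<A>"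
    and "\<And>x y. \<bar>g x - g y\<bar> \<le> 1 / R * norm (x - y)"
    and "state_after g K \<A> (primal_norm R) (potential R) T s"
  shows "run_invariant g K R T s"
  using assms(6) unfolding state_after_def
proof (induction T arbitrary: s)
  case 0
  then show ?case using run_invariant_init[OF assms(1), of g K] by auto
next
  case (Suc T)
  then show ?case
    using run_invariant_step[OF assms(1-5)] by (auto elim!: relpowp_Suc_E)
qed

section \<open>Distance of the hull from the origin when the upper bound is poor\<close>

text \<open>If a is large, the ball around z forces slack r |a|. If a is small, the normalization
  forces |b| \<ge> 1 while <a, z> stays below 1/2 in size, so the slack is at least 1/2.\<close>

lemma cut_slack_at_centre:
  fixes z a :: "'a::euclidean_space"
  assumes "R > 0" "0 < r" "r \<le> R" "cball z r \<subseteq> K" "K \<subseteq> cball 0 R"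
    and "(norm (rescale R (a, b)))\<^sup>2 = 2" "\<forall>y\<in>K. inner a y \<le> b"
  shows "b - inner a z \<ge> r / (2 * R)"
proof (cases "R * norm a \<ge> 1 / 2")
  case True
  then have a: "norm a > 0" using assms(1) by (auto simp: not_less)
  \<comment> \<open>The point of the ball that lies furthest in the direction
    \<open>a\<close>.\<close>
  have "z + (r / norm a) *\<^sub>R a \<in> K"
    using assms(2,4) a by (auto simp: dist_norm)
  then have "inner a z + r * norm a \<le> b"
    using assms(7) a
    by (force simp: inner_add_right power2_norm_eq_inner[symmetric] power2_eq_square)
  moreover have "r * norm a \<ge> r * (1 / (2 * R))"
    using True assms(1,2) by (intro mult_left_mono) (auto simp: field_simps)
  ultimately show ?thesis by simp
next
  case False
  have zK: "z \<in> K" using assms(2,4) by auto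
  then have "norm z \<le> R" using assms(5) by auto
  then have "\<bar>inner a z\<bar> \<le> norm a * R"
    by (meson Cauchy_Schwarz_ineq2 mult_left_mono norm_ge_zero order_trans)
  then have az: "\<bar>inner a z\<bar> < 1 / 2" using False by (simp add: mult.commute)
  have "(R * norm a)\<^sup>2 \<le> (1 / 2)\<^sup>2"
    using False assms(1) by (intro power_mono) auto
  then have "b\<^sup>2 \<ge> 1"
    using assms(6) unfolding norm_rescale_sq by (simp add: power_mult_distrib power_divide)
  then have "\<bar>b\<bar> \<ge> 1" by (simp add: abs_le_square_iff[of 1 b, simplified])
  \<comment> \<open>Validity of the cut at \<open>z\<close> excludes b \<le> -1, hence b \<ge>
    1.\<close>
  moreover have "inner a z \<le> b" using assms(7) zK by blast
  ultimately have "b - inner a z \<ge> 1 / 2" using az by linarith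
  moreover have "r / (2 * R) \<le> 1 / 2" using assms(1,3) by simp
  ultimately show ?thesis by linarith
qed

text \<open>Moving from \<open>m\<close> a fraction \<theta> of the way to \<open>z\<close> gains
  slack \<theta> r / (2 R) in every cut and costs at most 2 \<theta> in g, as K has diameter at most
  2 R. The resulting point defines a halfspace containing the hull.\<close>

lemma hull_far_from_origin:
  fixes K :: "'a::euclidean_space set"
  assumes "R > 0" "0 < r" "r \<le> R" "cball z r \<subseteq> K" "K \<subseteq> cball 0 R" "convex K"
    and lip: "\<And>x y. \<bar>g x - g y\<bar> \<le> 1 / R * norm (x - y)"
    and inv: "run_invariant g K R t s"
    and "m \<in> K" "e > 0" "ub s > ereal (g m + e)" "p \<in> hull_of s"
  shows "(min 1 (e / 4) * r / (2 * R))\<^sup>2 \<le> 2 * (norm (rescale R p))\<^sup>2"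
proof -
  \<comment> \<open>The cap 1 keeps \<open>y\<close> in the segment; e / 4 leaves e - 2 \<theta>
    \<ge> 2 \<theta>, enough slack for the subgradient points.\<close>
  define \<theta> where "\<theta> = min 1 (e / 4)"
  have \<theta>: "0 < \<theta>" "\<theta> \<le> 1" "4 * \<theta> \<le> e" using assms(10) by (auto simp: \<theta>_def)
  define \<tau> where "\<tau> = \<theta> * (r / (2 * R))"
  define y where "y = (1 - \<theta>) *\<^sub>R m + \<theta> *\<^sub>R z"
  have zK: "z \<in> K" using assms(2,4) by auto
  have y: "y \<in> K"
    unfolding y_def using \<theta> assms(6,9) zK by (intro convexD) auto
  have nK: "norm x \<le> R" if "x \<in> K" for x using that assms(5) by auto
  have "\<tau> \<ge> 0" using \<theta> assms(1,2) by (simp add: \<tau>_def)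
  have "r / (2 * R) \<le> 1" using assms(1-3) by simp
  then have "\<tau> \<le> \<theta> * 1" unfolding \<tau>_def using \<theta> by (intro mult_left_mono) auto
  have "y - m = \<theta> *\<^sub>R (z - m)" by (simp add: y_def algebra_simps)
  then have "norm (y - m) = \<theta> * norm (z - m)" using \<theta> by simp
  also have "\<dots> \<le> \<theta> * (2 * R)"
    using \<theta> norm_triangle_ineq4[of z m] nK[OF zK] nK[OF assms(9)] by (intro mult_left_mono) auto
  finally have "1 / R * norm (y - m) \<le> 1 / R * (\<theta> * (2 * R))"
    using assms(1) by (intro mult_left_mono) auto
  then have gy: "g y \<le> g m + 2 * \<theta>"
    using lip[of y m] assms(1) by simp
  have "cuts s \<union> subs s \<subseteq> {q. inner (- y, 1) q \<ge> \<tau>}"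
  proof (intro Un_least subsetI)
    fix q assume q: "q \<in> cuts s"
    obtain a b where ab: "q = (a, b)" by (cases q)
    have c: "(norm (rescale R (a, b)))\<^sup>2 = 2" "\<forall>y\<in>K. inner a y \<le> b"
      using inv q unfolding run_invariant_def ab by auto
    \<comment> \<open>The slack is affine in the point: it is nonnegative at \<open>m\<close> and at
      least r / (2 R) at \<open>z\<close>.\<close>
    have "b - inner a y = (1 - \<theta>) * (b - inner a m) + \<theta> * (b - inner a z)"
      by (simp add: y_def algebra_simps)
    also have "\<dots> \<ge> 0 + \<tau>"
      unfolding \<tau>_def using \<theta> c(2) assms(9) cut_slack_at_centre[OF assms(1-5) c]
      by (intro add_mono mult_nonneg_nonneg mult_left_mono) auto
    finally show "q \<in> {q. inner (- y, 1) q \<ge> \<tau>}"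
      by (simp add: ab inner_Pair inner_commute)
  next
    fix q assume q: "q \<in> subs s"
    obtain h c where hc: "q = (h, c)" by (cases q)
    obtain x where x: "subgradient g x h" "c = inner h x" "ub s \<le> ereal (g x)"
      using inv q unfolding run_invariant_def hc by auto
    have "ereal (g m + e) < ereal (g x)" using assms(11) x(3) by (rule less_le_trans)
    then have "g m + e < g x" by simp
    moreover have "g y \<ge> g x + inner h (y - x)" using x(1) by (simp add: subgradient_def)
    \<comment> \<open>The left side is <h, x - y> \<ge> g x - g y > e - 2 \<theta>.\<close>
    ultimately have "c - inner h y \<ge> \<tau>"
      using gy \<theta> \<open>\<tau> \<le> \<theta> * 1\<close> by (simp add: x(2) inner_diff_right)
    then show "q \<in> {q. inner (- y, 1) q \<ge> \<tau>}"
      by (simp add: hc inner_Pair inner_commute)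
  qed
  then have "hull_of s \<subseteq> {q. inner (- y, 1) q \<ge> \<tau>}"
    by (intro hull_minimal convex_halfspace_ge)
  then have "\<tau> \<le> inner (- y, 1) p" using assms(12) by auto
  \<comment> \<open>Rescaling \<open>p\<close> is compensated by dividing \<open>y\<close> by R; the
    new first component has norm at most 1, which gives the factor 2 below.\<close>
  also have "\<dots> = inner (- ((1 / R) *\<^sub>R y), 1) (rescale R p)"
    using assms(1) by (cases p) (simp add: inner_Pair)
  also have "\<dots> \<le> norm (- ((1 / R) *\<^sub>R y), 1::real) * norm (rescale R p)"
    by (rule norm_cauchy_schwarz)
  finally have "\<tau>\<^sup>2 \<le> (norm (- ((1 / R) *\<^sub>R y), 1::real))\<^sup>2 * (norm (rescale R p))\<^sup>2"
    using \<open>\<tau> \<ge> 0\<close> by (metis power_mono power_mult_distrib)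
  also have "\<dots> \<le> 2 * (norm (rescale R p))\<^sup>2"
  proof (intro mult_right_mono)
    have "(norm y / R)\<^sup>2 \<le> 1"
      using nK[OF y] assms(1) by (simp add: abs_square_le_1)
    then show "(norm (- ((1 / R) *\<^sub>R y), 1::real))\<^sup>2 \<le> 2"
      using assms(1) by (simp add: norm_Pair)
  qed auto
  finally show ?thesis by (simp add: \<tau>_def \<theta>_def)
qed

section \<open>The iteration count\<close>

text \<open>If the bound failed, the two distance estimates would give (T + 1) \<theta>^2 r^2 \<le>
  16 R^2, whereas the assumed T makes the left side exceed (1000 / 16) R^2.\<close>

lemma upper_bound_close:
  fixes K :: "'a::euclidean_space set"
  assumes "R > 0" "0 < r" "r \<le> R" "cball z r \<subseteq> K" "K \<subseteq> cball 0 R" "convex K"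
    and "\<And>x y. \<bar>g x - g y\<bar> \<le> 1 / R * norm (x - y)"
    and inv: "run_invariant g K R T s"
    and "m \<in> K" "e > 0" and T: "real T \<ge> 1000 * ((R\<^sup>2 / r\<^sup>2) * max 1 (1 / e\<^sup>2))"
  shows "ub s \<le> ereal (g m + e)"
proof (rule ccontr)
  assume "\<not> ?thesis"
  then have less: "ub s > ereal (g m + e)" by simp
  define \<theta> where "\<theta> = min 1 (e / 4)"
  have \<theta>: "0 < \<theta>" using assms(10) by (simp add: \<theta>_def)
  obtain p where p: "p \<in> hull_of s" "(real T + 1) * (norm (rescale R p))\<^sup>2 \<le> 2"
    using inv unfolding run_invariant_def by blast
  have "(real T + 1) * (\<theta> * r / (2 * R))\<^sup>2 \<le> (real T + 1) * (2 * (norm (rescale R p))\<^sup>2)"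
    unfolding \<theta>_def
    using hull_far_from_origin[OF assms(1-7) inv assms(9,10) less p(1)]
    by (intro mult_left_mono) auto
  then have "(real T + 1) * (\<theta> * r / (2 * R))\<^sup>2 \<le> 4" using p(2) by linarith
  then have "(real T + 1) * (\<theta>\<^sup>2 * r\<^sup>2) \<le> 16 * R\<^sup>2"
    using assms(1) by (simp add: power_divide power_mult_distrib field_simps)
  \<comment> \<open>The two branches of the maximum match those of \<theta>: 1 / e^2 serves \<theta>
    = e / 4, and 1 serves \<theta> = 1.\<close>
  moreover have "max 1 (1 / e\<^sup>2) * \<theta>\<^sup>2 \<ge> 1 / 16"
  proof (cases "e \<le> 4")
    case True
    then have "\<theta> = e / 4" by (simp add: \<theta>_def)
    then have "1 / e\<^sup>2 * \<theta>\<^sup>2 = 1 / 16"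
      using assms(10) unfolding \<open>\<theta> = e / 4\<close> by (simp add: power_divide)
    moreover have "1 / e\<^sup>2 * \<theta>\<^sup>2 \<le> max 1 (1 / e\<^sup>2) * \<theta>\<^sup>2" by (intro mult_right_mono) auto
    ultimately show ?thesis by linarith
  next
    case False
    then have "\<theta> = 1" by (simp add: \<theta>_def)
    then show ?thesis by simp
  qed
  then have "1000 * R\<^sup>2 * (1 / 16) \<le> 1000 * R\<^sup>2 * (max 1 (1 / e\<^sup>2) * \<theta>\<^sup>2)"
    by (intro mult_left_mono) auto
  moreover have "1000 * ((R\<^sup>2 / r\<^sup>2) * max 1 (1 / e\<^sup>2)) * (\<theta>\<^sup>2 * r\<^sup>2) \<le> real T * (\<theta>\<^sup>2 * r\<^sup>2)"
    using T by (intro mult_right_mono) auto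
  moreover have "1000 * ((R\<^sup>2 / r\<^sup>2) * max 1 (1 / e\<^sup>2)) * (\<theta>\<^sup>2 * r\<^sup>2)
      = 1000 * R\<^sup>2 * (max 1 (1 / e\<^sup>2) * \<theta>\<^sup>2)"
    using assms(2) by simp
  moreover have "\<theta>\<^sup>2 * r\<^sup>2 > 0" "R\<^sup>2 > 0" using \<theta> assms(1,2) by auto
  ultimately show False by (simp add: distrib_right)
qed

lemma radius_le_of_cball_subset:
  fixes z :: "'a::euclidean_space"
  assumes "r > 0" "cball z r \<subseteq> cball 0 R"
  shows "r \<le> R"
proof -
  have "dist z 0 + r \<le> R"
    using assms by (simp add: cball_subset_cball_iff)
  then show ?thesis using zero_le_dist[of z 0] by linarith
qed

(* The absolute constant is the numeral 1000: an existential over the constant could not be placed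
   outside the dimension CARD('n). The factor max 1 _ only matters for \<epsilon> > R * L; without it the
   claim fails for large \<epsilon>, since no point of K need have been queried yet. *)
theorem theorem2:
  fixes K :: "(real ^ 'n) set" and \<A> :: "((real ^ 'n) \<times> real) set"
    and f :: "real ^ 'n \<Rightarrow> real" and z :: "real ^ 'n" and R r L \<epsilon> :: real
    and T :: nat and s :: "(real ^ 'n) alg_state"
  assumes "R > 0" and "r > 0" and "L > 0"
    and "convex_body K" and "cball z r \<subseteq> K" and "K \<subseteq> cball 0 R"
    and "separation_oracle K \<A>"
    and "convex_on UNIV f" and "\<And>x y. \<bar>f x - f y\<bar> \<le> L * norm (x - y)"
    and "\<epsilon> > 0"
    and "real T \<ge> 1000 * ((R\<^sup>2 / r\<^sup>2) * max 1 (R\<^sup>2 * L\<^sup>2 / \<epsilon>\<^sup>2))"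
    and "state_after (\<lambda>x. 1 / (R * L) * f x) K \<A>
           (\<lambda>(x, y). sqrt 2 * norm ((1 / R) *\<^sub>R x, y))
           (\<lambda>(a, b). 1 / 4 * (norm (R *\<^sub>R a, b))\<^sup>2) T s"
  shows "\<exists>x\<^sub>m\<in>K. (\<forall>x\<in>K. f x\<^sub>m \<le> f x) \<and>
           ereal (R * L) * ub s \<ge> ereal (f x\<^sub>m) \<and>
           ereal (f x\<^sub>m) \<ge> ereal (R * L) * ub s - ereal \<epsilon>"
proof -
  define g where "g = (\<lambda>x. 1 / (R * L) * f x)"
  define e where "e = \<epsilon> / (R * L)"
  have RL: "R * L > 0" and fg: "f x = R * L * g x" and \<epsilon>: "\<epsilon> = R * L * e" for x
    using assms(1,3) by (auto simp: g_def e_def)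
  have ne: "K \<noteq> {}" and cK: "convex K" and cpt: "compact K"
    using assms(4) by (auto simp: convex_body_def)
  \<comment> \<open>Dividing f by R L turns the Lipschitz constant L into 1 / R.\<close>
  have lip: "\<bar>g x - g y\<bar> \<le> 1 / R * norm (x - y)" for x y
  proof -
    have "\<bar>g x - g y\<bar> = 1 / (R * L) * \<bar>f x - f y\<bar>"
      using assms(1,3) by (simp add: g_def abs_mult flip: diff_divide_distrib)
    also have "\<dots> \<le> 1 / (R * L) * (L * norm (x - y))"
      using RL assms(9) by (intro mult_left_mono) auto
    finally show ?thesis using assms(3) by simp
  qed
  have "L-lipschitz_on K f"
    using assms(3,9) by (intro lipschitz_onI) (auto simp: dist_norm)
  then obtain m where m: "m \<in> K" "\<forall>x\<in>K. f m \<le> f x"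
    using continuous_attains_inf[OF cpt ne] lipschitz_on_continuous_on by blast
  have inv: "run_invariant g K R T s"
    using assms(12) unfolding g_def[symmetric]
    by (rule run_invariant_state_after[OF assms(1) ne assms(6,7) lip])
  have "r \<le> R"
    using assms(2,5,6) by (intro radius_le_of_cball_subset[of r z]) auto
  moreover have "e > 0" using RL assms(10) by (simp add: e_def)
  moreover have "real T \<ge> 1000 * ((R\<^sup>2 / r\<^sup>2) * max 1 (1 / e\<^sup>2))"
    using assms(11) by (simp add: e_def power_divide power_mult_distrib)
  ultimately have le: "ub s \<le> ereal (g m + e)"
    using upper_bound_close[OF assms(1,2) _ assms(5,6) cK lip inv m(1)] by blast
  \<comment> \<open>A finite bound excludes the initial value \<infinity>, so it is the value of g
    at a point of K; this gives UB \<ge> min f.\<close>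
  then obtain x where x: "x \<in> K" "ub s = ereal (g x)"
    using inv unfolding run_invariant_def by auto
  have "g x \<le> g m + e" using le x by simp
  then have "R * L * g x \<le> R * L * (g m + e)" using RL by (intro mult_left_mono) auto
  then have "f x - \<epsilon> \<le> f m" by (simp add: fg \<epsilon> distrib_left)
  moreover have "f m \<le> f x" using m x by blast
  moreover have "ereal (R * L) * ub s = ereal (f x)"
    by (simp add: x fg)
  ultimately show ?thesis using m by (intro bexI[of _ m]) auto
qed

end
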